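(* Let $(\omega,\mathsf{k},\mathsf{a},A)$ be a point with $\omega>0$, $\mathsf{k}>1$ irrational and $\mathsf{a},A\in\mathbb{R}$. Let $(\mathsf{k}_v)_{v\le 0}$ be the backward orbit of $\mathsf{k}_0=\mathsf{k}$ under the renormalisation operator $\mathsf{T}$, and let $0=n_0>n_{-1}>n_{-2}>\cdots$ be the associated sequence of indices, both as defined in the context. Then the series of the unstable manifold $$\sum_{J=0}^{-\infty}\left[\prod_{j=-1}^{J}\left(-\mathsf{k}_{n_j}^{-1}\right)\sum_{n_{J-1}\le v<n_J}u(\mathsf{k}_v)\right]$$ converges (i.e. its partial sums over $J=0,-1,\dots,-N$ have a finite limit as $N\to\infty$) if and only if $$\lim_{j\to\infty}\frac{\log q_{j+1}\left(\mathsf{k}_{n_{-1}}^{-1}\right)}{q_j\left(\mathsf{k}_{n_{-1}}^{-1}\right)}=0,$$ where $q_j(x)$ denotes the denominator of the $j$th principal convergent of the continued fraction of $x$.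
   Context: The function $u$ is $$u(\mathsf{k})=\log\left(\frac{1}{2\pi^2}\cdot\frac{(1+\mathsf{k})^6}{\mathsf{k}^3}\right).$$ The MacKay approximate renormalisation operators are $$\mathsf{D}(\omega,\mathsf{k},\mathsf{a},A)=\left(\tfrac1\omega-1,\ \tfrac1{\mathsf{k}}+1,\ A,\ A+\mathsf{a}+u(\mathsf{k})\right)\quad(\omega\in(0,1),\ \mathsf{k}>1),$$ $$\mathsf{S}(\omega,\mathsf{k},\mathsf{a},A)=\left(\omega-1,\ \mathsf{k}+1,\ \mathsf{a},\ A+\mathsf{a}+u(\mathsf{k})\right)\quad(\omega>1,\ \mathsf{k}>1),$$ and $\mathsf{T}=\mathsf{D}$ if $\omega\in(0,1)$, $\mathsf{T}=\mathsf{S}$ if $\omega>1$. The inverse is $\mathsf{T}^{-1}=\mathsf{S}^{-1}$ at points with $\mathsf{k}>2$ and $\mathsf{T}^{-1}=\mathsf{D}^{-1}$ at points with $\mathsf{k}<2$. Write $(\omega_v,\mathsf{k}_v,\mathsf{a}_v,A_v)=\mathsf{T}^v(\omega,\mathsf{k},\mathsf{a},A)$. For $v\le 0$ the second coordinate depends only on $\mathsf{k}$: $\mathsf{k}_0=\mathsf{k}$ and, for $v\le 0$, $$\mathsf{k}_{v-1}=\begin{cases}\mathsf{k}_v-1&\text{if }\mathsf{k}_v>2\quad(\text{a step } \mathsf{S}^{-1}),\\ \dfrac{1}{\mathsf{k}_v-1}&\text{if }1<\mathsf{k}_v<2\quad(\text{a step }\mathsf{D}^{-1}).\end{cases}$$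 For irrational $\mathsf{k}>1$ this is defined for all $v\le0$, and each $\mathsf{k}_v$ is irrational and $>1$. The indices $n_j$, $j\le 0$, are defined by $n_0=0$ and, for $j<0$, $n_j$ is the largest $i<n_{j+1}$ such that $\mathsf{T}^{-1}$ acts as $\mathsf{D}^{-1}$ at the point $\mathsf{T}^{i+1}(\omega,\mathsf{k},\mathsf{a},A)$; that is, $$n_j=\max\{i<n_{j+1}:\ \mathsf{k}_{i+1}<2\}.$$ The product $\prod_{j=-1}^{J}$ runs over $j=-1,-2,\dots,J$ for $J\le -1$, with the convention $\prod_{j=-1}^{0}(-\mathsf{k}_{n_j}^{-1})=1$. The unstable manifold of the renormalisation scheme is the set given by the equation $A_0-\mathsf{k}\,\mathsf{a}_0-\sum_{J=0}^{-\infty}[\cdots]=0$, where the sum is the series in the claim. For a positive irrational $x$ with standard (regular) continued fraction expansion $x=[a_0(x);a_1(x),a_2(x),\dots]$, $p_n(x)/q_n(x)=[a_0(x);a_1(x),\dots,a_n(x)]$ is the $n$th principal convergent in lowest terms, with $q_n(x)\ge1$. *)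

theory Defs
  imports "HOL-Analysis.Analysis"
begin

section \<open>The approximate renormalisation operators\<close>

text \<open>Points are quadruples \<open>(\<omega>, k, a, A)\<close>.\<close>

type_synonym rpoint = "real \<times> real \<times> real \<times> real"

fun coord_k :: "rpoint \<Rightarrow> real" where
  "coord_k (\<omega>, k, a, A) = k"

definition u :: "real \<Rightarrow> real" where
  "u k = ln (1 / (2 * pi\<^sup>2) * ((1 + k) ^ 6 / k ^ 3))"

fun renorm_D :: "rpoint \<Rightarrow> rpoint" where
  "renorm_D (\<omega>, k, a, A) = (1 / \<omega> - 1, 1 / k + 1, A, A + a + u k)"

fun renorm_S :: "rpoint \<Rightarrow> rpoint" where
  "renorm_S (\<omega>, k, a, A) = (\<omega> - 1, k + 1, a, A + a + u k)"

text \<open>The operator \<open>T\<close> is only meaningful for positive \<open>\<omega> \<noteq> 1\<close> and \<open>k > 1\<close>; its value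
  elsewhere is irrelevant.\<close>

fun renorm_T :: "rpoint \<Rightarrow> rpoint" where
  "renorm_T (\<omega>, k, a, A) =
     (if \<omega> < 1 then renorm_D (\<omega>, k, a, A) else renorm_S (\<omega>, k, a, A))"

fun renorm_D_inv :: "rpoint \<Rightarrow> rpoint" where
  "renorm_D_inv (\<omega>, k, a, A) =
     (1 / (\<omega> + 1), 1 / (k - 1), A - a - u (1 / (k - 1)), a)"

fun renorm_S_inv :: "rpoint \<Rightarrow> rpoint" where
  "renorm_S_inv (\<omega>, k, a, A) = (\<omega> + 1, k - 1, a, A - a - u (k - 1))"

text \<open>The value at \<open>k = 2\<close> is irrelevant: it never occurs on backward orbits with irrational \<open>k\<close>.\<close>

definition renorm_T_inv :: "rpoint \<Rightarrow> rpoint" where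
  "renorm_T_inv p = (if coord_k p < 2 then renorm_D_inv p else renorm_S_inv p)"

lemma renorm_T_renorm_T_inv:
  assumes "\<omega> > 0" "k > 1"
  shows "renorm_T (renorm_T_inv (\<omega>, k, a, A)) = (\<omega>, k, a, A)"
  using assms by (simp add: renorm_T_inv_def divide_less_eq)

lemma renorm_T_inv_renorm_T:
  assumes "\<omega> > 0" "\<omega> \<noteq> 1" "k > 1"
  shows "renorm_T_inv (renorm_T (\<omega>, k, a, A)) = (\<omega>, k, a, A)"
  using assms by (auto simp: renorm_T_inv_def divide_less_eq)

definition renorm_T_pow :: "int \<Rightarrow> rpoint \<Rightarrow> rpoint" where
  "renorm_T_pow v p =
     (if v \<ge> 0 then (renorm_T ^^ nat v) p else (renorm_T_inv ^^ nat (- v)) p)"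

definition k_orbit :: "rpoint \<Rightarrow> int \<Rightarrow> real" where
  "k_orbit p v = coord_k (renorm_T_pow v p)"

lemma k_orbit_0: "k_orbit (\<omega>, k, a, A) 0 = k"
  by (simp add: k_orbit_def renorm_T_pow_def)

lemma k_orbit_backward_step:
  assumes "v \<le> 0"
  shows "k_orbit p (v - 1) =
    (if k_orbit p v < 2 then 1 / (k_orbit p v - 1) else k_orbit p v - 1)"
proof -
  have pow: "renorm_T_pow w p = (renorm_T_inv ^^ nat (- w)) p" if "w \<le> 0" for w
    using that by (cases "w = 0") (simp_all add: renorm_T_pow_def)
  have "nat (- (v - 1)) = Suc (nat (- v))"
    using assms by simp
  then have "renorm_T_pow (v - 1) p = renorm_T_inv (renorm_T_pow v p)"
    using assms by (simp add: pow)
  then show ?thesis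
    by (cases "renorm_T_pow v p") (simp add: k_orbit_def renorm_T_inv_def)
qed

section \<open>The series of the unstable manifold\<close>

text \<open>\<open>D_index_aux p m\<close> is \<open>n\<^sub>-\<^sub>m\<close>; the condition \<open>k_orbit p (i + 1) < 2\<close> says that
  \<open>T\<^sup>-\<^sup>1\<close> acts as \<open>D\<^sup>-\<^sup>1\<close> at \<open>T\<^sup>i\<^sup>+\<^sup>1 p\<close>.\<close>

primrec D_index_aux :: "rpoint \<Rightarrow> nat \<Rightarrow> int" where
  "D_index_aux p 0 = 0"
| "D_index_aux p (Suc m) = (GREATEST i. i < D_index_aux p m \<and> k_orbit p (i + 1) < 2)"

text \<open>The index \<open>n\<^sub>j\<close>, for \<open>j \<le> 0\<close>.\<close>

definition D_index :: "rpoint \<Rightarrow> int \<Rightarrow> int" where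
  "D_index p j = D_index_aux p (nat (- j))"

text \<open>The summand with index \<open>J \<le> 0\<close>; for \<open>J = 0\<close> the product over \<open>{0..-1}\<close> is empty.\<close>

definition unstable_summand :: "rpoint \<Rightarrow> int \<Rightarrow> real" where
  "unstable_summand p J =
     (\<Prod>j\<in>{J..-1}. - inverse (k_orbit p (D_index p j))) *
     (\<Sum>v\<in>{D_index p (J - 1)..<D_index p J}. u (k_orbit p v))"

section \<open>Regular continued fractions\<close>

primrec cf_complete_quotient :: "real \<Rightarrow> nat \<Rightarrow> real" where
  "cf_complete_quotient x 0 = x"
| "cf_complete_quotient x (Suc n) = 1 / frac (cf_complete_quotient x n)"

definition cf_partial_quotient :: "real \<Rightarrow> nat \<Rightarrow> int" where
  "cf_partial_quotient x n = \<lfloor>cf_complete_quotient x n\<rfloor>"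

fun cf_value :: "int list \<Rightarrow> rat" where
  "cf_value [] = 0"
| "cf_value [c] = of_int c"
| "cf_value (c # d # ds) = of_int c + 1 / cf_value (d # ds)"

definition cf_convergent :: "real \<Rightarrow> nat \<Rightarrow> rat" where
  "cf_convergent x n = cf_value (map (cf_partial_quotient x) [0..<Suc n])"

text \<open>\<open>quotient_of\<close> yields numerator and denominator in lowest terms, with positive denominator.\<close>

definition cf_denom :: "real \<Rightarrow> nat \<Rightarrow> int" where
  "cf_denom x n = snd (quotient_of (cf_convergent x n))"

end

theory Submission
  imports Defs
begin

text \<open>
  The points \<open>K m = k_orbit p (n\<^sub>-\<^sub>m)\<close> are the complete quotients of \<open>k\<close>. With \<open>P m = K 1 \<cdots> K m\<close>
  the summand of index \<open>-m\<close> is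
  \<open>(-1) ^ m / P m * (u (K (m + 1)) + (\<Sum>i = 1..\<lfloor>K m\<rfloor> - 1. u (K m - i)))\<close>. Since \<open>u y = 3 ln y + O(1)\<close>,
  a Stirling estimate turns it into \<open>(-1) ^ m * (t m + t (m - 1)) + O(1 / P (m - 1))\<close> where
  \<open>t m = 3 ln (K (m + 1)) / P m\<close>. The errors are summable and the main terms telescope to
  \<open>(-1) ^ m * t m\<close>, so the series converges iff \<open>t m \<longlonglongrightarrow> 0\<close>. Finally \<open>q\<^sub>m \<le> P m \<le> 2 q\<^sub>m\<close>, and
  \<open>ln (K (m + 1)) = ln (P (m + 1)) - ln (P m)\<close>.
\<close>

section \<open>Complete quotients\<close>

declare cf_complete_quotient.simps(2) [simp del]
lemmas cf_complete_quotient_Suc = cf_complete_quotient.simps(2)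

lemma frac_pos_irrational: "0 < frac y" if "y \<notin> \<rat>" for y :: real
  using that Ints_subset_Rats frac_gt_0_iff by blast

lemma cf_complete_quotient_irrational:
  assumes "k \<notin> \<rat>"
  shows "cf_complete_quotient k n \<notin> \<rat>"
proof (induction n)
  case 0
  show ?case using assms by simp
next
  case (Suc n)
  let ?y = "cf_complete_quotient k n"
  show ?case
  proof
    assume "cf_complete_quotient k (Suc n) \<in> \<rat>"
    then have "inverse (frac ?y) \<in> \<rat>"
      by (simp add: cf_complete_quotient_Suc divide_inverse)
    then have "frac ?y \<in> \<rat>"
      using Rats_inverse by fastforce
    then have "frac ?y + of_int \<lfloor>?y\<rfloor> \<in> \<rat>"
      by (intro Rats_add) auto
    then show False
      using Suc by (simp add: frac_def)
  qed
qed

lemma cf_complete_quotient_gt_1: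
  assumes "k \<notin> \<rat>"
  shows "cf_complete_quotient k (Suc n) > 1"
  using frac_pos_irrational[OF cf_complete_quotient_irrational[OF assms, of n]]
    frac_lt_1[of "cf_complete_quotient k n"] by (simp add: cf_complete_quotient_Suc)

text \<open>The growth condition concerns \<open>frac k\<close> while the orbit produces the
  complete quotients of \<open>k\<close>; the two sequences differ only at index 0, because
  \<open>frac (frac k) = frac k\<close>.\<close>

lemma cf_complete_quotient_frac:
  "cf_complete_quotient (frac k) (Suc n) = cf_complete_quotient k (Suc n)"
  by (induction n) (simp_all add: cf_complete_quotient_Suc)

section \<open>Denominators of convergents\<close>

text \<open>Numerator and denominator of \<open>cf_value\<close>; the empty list stands for \<open>1/0\<close>, the value that makes
  the recursion uniform, whereas \<open>cf_value [] = 0\<close>.\<close>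

primrec cf_pair :: "int list \<Rightarrow> int \<times> int" where
  "cf_pair [] = (1, 0)"
| "cf_pair (c # cs) = (c * fst (cf_pair cs) + snd (cf_pair cs), fst (cf_pair cs))"

text \<open>\<open>cf_pair\<close> recurses at the head, but convergents grow at the end of the
  list. Prepending an entry applies one linear map to all three pairs, so the three-term relation
  survives the induction.\<close>

lemma cf_pair_append2:
  "fst (cf_pair (cs @ [c, d])) = d * fst (cf_pair (cs @ [c])) + fst (cf_pair cs)"
  "snd (cf_pair (cs @ [c, d])) = d * snd (cf_pair (cs @ [c])) + snd (cf_pair cs)"
  by (induction cs) (simp_all add: algebra_simps)

lemma coprime_cf_pair: "coprime (fst (cf_pair cs)) (snd (cf_pair cs))"
proof (induction cs)
  case (Cons c cs)
  have "gcd (snd (cf_pair cs) + c * fst (cf_pair cs)) (fst (cf_pair cs)) =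
      gcd (snd (cf_pair cs)) (fst (cf_pair cs))"
    by (metis gcd.commute gcd_add_mult add.commute)
  then show ?case
    using Cons by (simp add: coprime_iff_gcd_eq_1 gcd.commute add.commute)
qed simp

lemma cf_pair_pos:
  assumes "\<forall>c\<in>set cs. c > 0"
  shows "fst (cf_pair cs) > 0 \<and> snd (cf_pair cs) \<ge> 0"
  using assms by (induction cs) (simp_all add: add_pos_nonneg)

text \<open>Positivity is asked of the tail only, since the leading partial quotient of a number in
  (0,1), such as \<open>frac k\<close>, is 0.\<close>

lemma cf_value_cf_pair:
  assumes "cs \<noteq> []" "\<forall>c\<in>set (tl cs). c > 0"
  shows "cf_value cs = of_int (fst (cf_pair cs)) / of_int (snd (cf_pair cs))"
  using assms
proof (induction cs rule: cf_value.induct)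
  case (3 c d ds)
  \<comment> \<open>The numerator of the tail is the denominator of the whole fraction.\<close>
  have "fst (cf_pair (d # ds)) > 0"
    using 3 cf_pair_pos by (metis list.sel(3))
  then have "rat_of_int (fst (cf_pair (d # ds))) \<noteq> 0"
    by (simp only: of_int_eq_0_iff)
  then have "of_int c + 1 / (rat_of_int (fst (cf_pair (d # ds))) / of_int (snd (cf_pair (d # ds)))) =
      (of_int c * of_int (fst (cf_pair (d # ds))) + of_int (snd (cf_pair (d # ds)))) /
        of_int (fst (cf_pair (d # ds)))"
    by (simp add: add_divide_distrib del: cf_pair.simps)
  moreover have "cf_value (d # ds) = of_int (fst (cf_pair (d # ds))) / of_int (snd (cf_pair (d # ds)))"
    using 3 by simp
  ultimately show ?case
    by (simp only: cf_value.simps cf_pair.simps(2)[of c] fst_conv snd_conv of_int_add of_int_mult)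
qed simp_all

lemma snd_quotient_of_cf_value:
  assumes "cs \<noteq> []" "\<forall>c\<in>set (tl cs). c > 0"
  shows "snd (quotient_of (cf_value cs)) = snd (cf_pair cs)"
proof -
  have "snd (cf_pair cs) > 0"
    using assms cf_pair_pos[of "tl cs"] by (cases cs) auto
  then have "quotient_of (cf_value cs) = cf_pair cs"
    using cf_value_cf_pair[OF assms] coprime_cf_pair[of cs]
    by (cases "cf_pair cs") (simp add: quotient_of_Fract Fract_of_int_quotient[symmetric])
  then show ?thesis by simp
qed

context
  fixes x :: real
  assumes irrational_x: "x \<notin> \<rat>"
begin

lemma cf_partial_quotient_pos: "cf_partial_quotient x (Suc n) \<ge> 1"
  using cf_complete_quotient_gt_1[OF irrational_x, of n] unfolding cf_partial_quotient_def
  by linarith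

lemma cf_denom_eq:
  "cf_denom x n = snd (cf_pair (map (cf_partial_quotient x) [0..<Suc n]))"
proof -
  let ?cs = "map (cf_partial_quotient x) [0..<Suc n]"
  have "tl ?cs = map (cf_partial_quotient x) [Suc 0..<Suc n]"
    by (simp add: upt_conv_Cons del: upt_Suc)
  moreover have "cf_partial_quotient x i > 0" if "i \<in> set [Suc 0..<Suc n]" for i
  proof -
    have "i = Suc (i - 1)"
      using that by (auto simp del: upt_Suc)
    then show ?thesis
      using cf_partial_quotient_pos[of "i - 1"] by (metis zero_less_one order_less_le_trans)
  qed
  ultimately have "\<forall>c\<in>set (tl ?cs). c > 0"
    by (metis (no_types, lifting) imageE list.set_map)
  then show ?thesis
    unfolding cf_denom_def cf_convergent_def by (intro snd_quotient_of_cf_value) auto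
qed

lemma cf_denom_0: "cf_denom x 0 = 1"
  by (simp add: cf_denom_eq)

lemma cf_denom_1: "cf_denom x (Suc 0) = cf_partial_quotient x (Suc 0)"
  by (simp add: cf_denom_eq)

lemma cf_denom_Suc_Suc:
  "cf_denom x (Suc (Suc n)) =
     cf_partial_quotient x (Suc (Suc n)) * cf_denom x (Suc n) + cf_denom x n"
proof -
  let ?f = "cf_partial_quotient x"
  have "map ?f [0..<Suc (Suc (Suc n))] = map ?f [0..<Suc n] @ [?f (Suc n), ?f (Suc (Suc n))]"
    "map ?f [0..<Suc (Suc n)] = map ?f [0..<Suc n] @ [?f (Suc n)]"
    by simp_all
  then show ?thesis
    unfolding cf_denom_eq by (simp only: cf_pair_append2)
qed

lemma cf_denom_ge_1_mono: "1 \<le> cf_denom x n \<and> cf_denom x n \<le> cf_denom x (Suc n)"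
proof (induction n)
  case 0
  then show ?case
    using cf_partial_quotient_pos[of 0] by (simp add: cf_denom_0 cf_denom_1)
next
  case (Suc n)
  have "1 * cf_denom x (Suc n) \<le> cf_partial_quotient x (Suc (Suc n)) * cf_denom x (Suc n)"
    using Suc cf_partial_quotient_pos[of "Suc n"] by (intro mult_right_mono) auto
  then show ?case
    using Suc unfolding cf_denom_Suc_Suc by linarith
qed

end

section \<open>Products of complete quotients and their comparison with the denominators\<close>

definition cf_quotient_prod :: "real \<Rightarrow> nat \<Rightarrow> real" where
  "cf_quotient_prod x n = (\<Prod>j=1..n. cf_complete_quotient x j)"

lemma cf_quotient_prod_0 [simp]: "cf_quotient_prod x 0 = 1"
  by (simp add: cf_quotient_prod_def)

lemma cf_quotient_prod_Suc:
  "cf_quotient_prod x (Suc n) = cf_complete_quotient x (Suc n) * cf_quotient_prod x n"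
  by (simp add: cf_quotient_prod_def)

lemma cf_quotient_prod_frac: "cf_quotient_prod (frac k) n = cf_quotient_prod k n"
  by (induction n) (simp_all only: cf_quotient_prod_0 cf_quotient_prod_Suc cf_complete_quotient_frac)

context
  fixes x :: real
  assumes irrational_x: "x \<notin> \<rat>"
begin

lemma cf_complete_quotient_step:
  "cf_complete_quotient x (Suc n) * frac (cf_complete_quotient x n) = 1"
  using frac_pos_irrational[OF cf_complete_quotient_irrational[OF irrational_x, of n]]
  by (simp add: cf_complete_quotient_Suc)

text \<open>Since \<open>frac\<close> of a complete quotient is the inverse of the next one,
  multiplying the identity by the next complete quotient turns the remainder into
  \<open>cf_denom x n\<close>, and the recurrence of the denominators takes over. The remainder is
  at most the leading term, whence the factor 2 in \<open>cf_quotient_prod_bounds\<close>.\<close>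

lemma cf_quotient_prod_eq:
  "cf_quotient_prod x (Suc n) =
     of_int (cf_denom x (Suc n)) + of_int (cf_denom x n) * frac (cf_complete_quotient x (Suc n))"
proof (induction n)
  case 0
  show ?case
    by (simp add: cf_quotient_prod_Suc cf_denom_0[OF irrational_x] cf_denom_1[OF irrational_x]
        cf_partial_quotient_def
        frac_def)
next
  case (Suc n)
  let ?y = "cf_complete_quotient x (Suc n)" and ?z = "cf_complete_quotient x (Suc (Suc n))"
  have z: "?z = of_int (cf_partial_quotient x (Suc (Suc n))) + frac ?z"
    by (simp add: cf_partial_quotient_def frac_def)
  have "cf_quotient_prod x (Suc (Suc n)) =
      ?z * of_int (cf_denom x (Suc n)) + of_int (cf_denom x n) * (?z * frac ?y)"
    unfolding cf_quotient_prod_Suc[of x "Suc n"] Suc by (simp add: algebra_simps)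
  also have "\<dots> = ?z * of_int (cf_denom x (Suc n)) + of_int (cf_denom x n)"
    using cf_complete_quotient_step[of "Suc n"] by simp
  also have "\<dots> = (of_int (cf_partial_quotient x (Suc (Suc n))) + frac ?z) * of_int (cf_denom x (Suc n))
      + of_int (cf_denom x n)"
    using z by simp
  finally show ?case
    by (simp add: cf_denom_Suc_Suc[OF irrational_x] algebra_simps
       )
qed

lemma cf_quotient_prod_bounds:
  "of_int (cf_denom x n) \<le> cf_quotient_prod x n"
  "cf_quotient_prod x n \<le> 2 * of_int (cf_denom x n)"
proof -
  have "of_int (cf_denom x n) \<le> cf_quotient_prod x n \<and>
      cf_quotient_prod x n \<le> 2 * of_int (cf_denom x n)"
  proof (cases n)
    case 0
    then show ?thesis by (simp add: cf_denom_0[OF irrational_x])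
  next
    case (Suc m)
    let ?r = "of_int (cf_denom x m) * frac (cf_complete_quotient x (Suc m))"
    have "0 \<le> (of_int (cf_denom x m) :: real)"
      "(of_int (cf_denom x m) :: real) \<le> of_int (cf_denom x (Suc m))"
      using cf_denom_ge_1_mono[OF irrational_x, of m] by auto
    then have "0 \<le> ?r \<and> ?r \<le> of_int (cf_denom x (Suc m)) * 1"
      by (intro conjI mult_nonneg_nonneg mult_mono) (auto simp: frac_lt_1 less_imp_le)
    then show ?thesis
      unfolding Suc cf_quotient_prod_eq by simp
  qed
  then show "of_int (cf_denom x n) \<le> cf_quotient_prod x n"
    "cf_quotient_prod x n \<le> 2 * of_int (cf_denom x n)" by auto
qed

lemma cf_quotient_prod_ge_1: "1 \<le> cf_quotient_prod x n"
  using cf_quotient_prod_bounds(1)[of n] cf_denom_ge_1_mono[OF irrational_x, of n]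
  by (meson of_int_1_le_iff order_trans)

text \<open>After division by \<open>inverse ?P * inverse ?y\<close> this is 1/z \<le> y - 1, true
  because 1/z is the fractional part of y and y has integer part at least 1. The right-hand side
  telescopes, which gives summability without an explicit growth rate.\<close>

lemma inverse_cf_quotient_prod_step:
  "inverse (cf_quotient_prod x (Suc (Suc n))) \<le>
     inverse (cf_quotient_prod x n) - inverse (cf_quotient_prod x (Suc n))"
proof -
  let ?P = "cf_quotient_prod x n"
  let ?y = "cf_complete_quotient x (Suc n)" and ?z = "cf_complete_quotient x (Suc (Suc n))"
  have y: "?y > 1" and z: "?z > 1"
    using cf_complete_quotient_gt_1[OF irrational_x] by blast+
  have "\<lfloor>?y\<rfloor> \<ge> 1"
    using y by linarith
  then have "1 \<le> ?y - frac ?y"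
    by (simp add: frac_def)
  moreover have "inverse ?z = frac ?y"
    by (simp add: cf_complete_quotient_Suc)
  ultimately have "inverse ?z \<le> ?y - 1"
    by linarith
  then have "inverse ?P * inverse ?y * inverse ?z \<le> inverse ?P * inverse ?y * (?y - 1)"
    using cf_quotient_prod_ge_1[of n] y by (intro mult_left_mono) auto
  also have "\<dots> = inverse ?P - inverse ?P * inverse ?y"
    using y by (simp add: algebra_simps)
  finally show ?thesis
    by (simp add: cf_quotient_prod_Suc ac_simps)
qed

lemma summable_inverse_cf_quotient_prod: "summable (\<lambda>n. inverse (cf_quotient_prod x n))"
proof -
  let ?b = "\<lambda>n. inverse (cf_quotient_prod x n)"
  have b: "?b n \<ge> 0" for n
    using cf_quotient_prod_ge_1[of n] by simp
  have "(\<Sum>n<N. ?b (Suc (Suc n))) \<le> ?b 0 - ?b N" for N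
  proof (induction N)
    case (Suc N)
    then show ?case
      using inverse_cf_quotient_prod_step[of N] by (simp)
  qed simp
  then have "(\<Sum>n<N. ?b (Suc (Suc n))) \<le> ?b 0" for N
    using b[of N] by (smt (verit))
  then have "summable (\<lambda>n. ?b (Suc (Suc n)))"
    using b by (intro summableI_nonneg_bounded) auto
  then have "summable (\<lambda>n. ?b (Suc n))"
    by (subst (asm) summable_Suc_iff)
  then show ?thesis
    by (subst (asm) summable_Suc_iff)
qed

lemma filterlim_cf_quotient_prod: "filterlim (cf_quotient_prod x) at_top sequentially"
proof -
  have "eventually (\<lambda>n. 0 < inverse (cf_quotient_prod x n)) sequentially"
    using cf_quotient_prod_ge_1 by (intro always_eventually) (smt (verit) positive_imp_inverse_positive)
  then have "filterlim (\<lambda>n. inverse (inverse (cf_quotient_prod x n))) at_top sequentially"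
    using summable_LIMSEQ_zero[OF summable_inverse_cf_quotient_prod]
    by (intro filterlim_inverse_at_top)
  then show ?thesis by simp
qed

text \<open>Both quotients are compared with \<open>M j = ln (P (j + 1)) / P j\<close>, where P is
  \<open>cf_quotient_prod x\<close>. Passing to \<open>?R\<close> subtracts ln P / P, which vanishes
  because P tends to infinity; passing to \<open>?L\<close> costs only bounded factors and a
  multiple of 1/P, because P lies between q and 2q.\<close>

lemma ln_cf_denom_tendsto_iff:
  "(\<lambda>j. ln (real_of_int (cf_denom x (Suc j))) / real_of_int (cf_denom x j)) \<longlonglongrightarrow> 0 \<longleftrightarrow>
   (\<lambda>j. ln (cf_complete_quotient x (Suc j)) / cf_quotient_prod x j) \<longlonglongrightarrow> 0"
  (is "?L \<longlonglongrightarrow> 0 \<longleftrightarrow> ?R \<longlonglongrightarrow> 0")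
proof -
  let ?P = "cf_quotient_prod x" and ?q = "\<lambda>j. real_of_int (cf_denom x j)"
  have P1: "1 \<le> ?P j" for j
    by (rule cf_quotient_prod_ge_1)
  have q1: "1 \<le> ?q j" for j
    using cf_denom_ge_1_mono[OF irrational_x, of j] by simp
  note qP = cf_quotient_prod_bounds
  have "((\<lambda>y::real. ln y / y) \<longlongrightarrow> 0) at_top"
    by (rule ln_x_over_x_tendsto_0)
  then have lnP: "(\<lambda>j. ln (?P j) / ?P j) \<longlonglongrightarrow> 0"
    by (rule filterlim_compose[OF _ filterlim_cf_quotient_prod])
  have invP: "(\<lambda>j. inverse (?P j)) \<longlonglongrightarrow> 0"
    by (rule summable_LIMSEQ_zero[OF summable_inverse_cf_quotient_prod])
  define M where "M j = ln (?P (Suc j)) / ?P j" for j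
  have R_eq: "?R j = M j - ln (?P j) / ?P j" for j
  proof -
    have "ln (?P (Suc j)) = ln (cf_complete_quotient x (Suc j)) + ln (?P j)"
      using P1[of j] cf_complete_quotient_gt_1[OF irrational_x, of j]
      by (simp add: cf_quotient_prod_Suc ln_mult)
    then show ?thesis
      by (simp add: M_def add_divide_distrib)
  qed
  have RM: "?R \<longlonglongrightarrow> 0 \<longleftrightarrow> M \<longlonglongrightarrow> 0"
  proof
    assume "?R \<longlonglongrightarrow> 0"
    from tendsto_add[OF this lnP] show "M \<longlonglongrightarrow> 0"
      by (simp add: R_eq)
  next
    assume "M \<longlonglongrightarrow> 0"
    from tendsto_diff[OF this lnP] show "?R \<longlonglongrightarrow> 0"
      by (simp add: R_eq)
  qed
  have L0: "0 \<le> ?L j" for j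
    using q1[of j] q1[of "Suc j"] by simp
  have M0: "0 \<le> M j" for j
    unfolding M_def using P1[of j] P1[of "Suc j"] by (intro divide_nonneg_nonneg) (auto)
  have L_le_M: "?L j \<le> 2 * M j" for j
  proof -
    have "?L j \<le> ln (?P (Suc j)) / (?P j / 2)"
      using q1[of j] q1[of "Suc j"] qP[of j] qP[of "Suc j"] P1[of j] P1[of "Suc j"]
      by (intro frac_le) (auto)
    then show ?thesis
      by (simp add: M_def mult.commute)
  qed
  have M_le_L: "M j \<le> ?L j + ln 2 * inverse (?P j)" for j
  proof -
    have "ln (?P (Suc j)) \<le> ln (2 * ?q (Suc j))"
      using qP[of "Suc j"] P1[of "Suc j"] q1[of "Suc j"] by (subst ln_le_cancel_iff) linarith+
    also have "\<dots> = ln 2 + ln (?q (Suc j))"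
      using q1[of "Suc j"] by (subst ln_mult) auto
    finally have "M j \<le> (ln 2 + ln (?q (Suc j))) / ?P j"
      unfolding M_def using P1[of j] by (intro divide_right_mono) linarith+
    also have "\<dots> = ln (?q (Suc j)) / ?P j + ln 2 * inverse (?P j)"
      by (simp add: add_divide_distrib divide_inverse algebra_simps)
    also have "ln (?q (Suc j)) / ?P j \<le> ?L j"
      using q1[of j] q1[of "Suc j"] qP[of j] P1[of j] by (intro frac_le) auto
    finally show ?thesis by simp
  qed
  have "?L \<longlonglongrightarrow> 0 \<longleftrightarrow> M \<longlonglongrightarrow> 0"
  proof
    assume L: "?L \<longlonglongrightarrow> 0"
    have "(\<lambda>j. ?L j + ln 2 * inverse (?P j)) \<longlonglongrightarrow> 0"
      using tendsto_add[OF L tendsto_mult_right_zero[OF invP, of "ln 2"]] by simp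
    then show "M \<longlonglongrightarrow> 0"
      by (rule tendsto_sandwich[OF _ _ tendsto_const, rotated 2]) (simp_all only: M0 M_le_L eventually_True)
  next
    assume "M \<longlonglongrightarrow> 0"
    then have "(\<lambda>j. 2 * M j) \<longlonglongrightarrow> 0"
      by (rule tendsto_mult_right_zero)
    then show "?L \<longlonglongrightarrow> 0"
      by (rule tendsto_sandwich[OF _ _ tendsto_const, rotated 2]) (simp_all only: L0 L_le_M eventually_True)
  qed
  with RM show ?thesis by simp
qed

end

section \<open>The function \<open>u\<close> and Stirling's estimate\<close>

text \<open>Expanding the logarithm gives a constant plus 6 ln (1 + y) - 3 ln y, and ln (1 + y)
  exceeds ln y by at most ln 2 for y > 1.\<close>

lemma u_approx: "\<exists>R\<ge>0. \<forall>y>1. \<bar>u y - 3 * ln y\<bar> \<le> R"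
proof (intro exI[of _ "\<bar>ln (1 / (2 * pi\<^sup>2))\<bar> + 6 * ln 2"] conjI allI impI)
  fix y :: real
  assume y: "y > 1"
  have eq: "u y = ln (1 / (2 * pi\<^sup>2)) + (6 * ln (1 + y) - 3 * ln y)"
    unfolding u_def using y by (subst ln_mult) (auto simp: ln_div ln_realpow)
  have "ln (1 + y) \<le> ln (2 * y)"
    using y by (subst ln_le_cancel_iff) auto
  then have "ln (1 + y) \<le> ln 2 + ln y"
    using y by (simp add: ln_mult)
  moreover have "ln y \<le> ln (1 + y)"
    using y by simp
  ultimately show "\<bar>u y - 3 * ln y\<bar> \<le> \<bar>ln (1 / (2 * pi\<^sup>2))\<bar> + 6 * ln 2"
    unfolding eq by linarith
qed simp

lemma ln_step_bound:
  fixes y :: real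
  assumes "y > 1"
  shows "(y - 1) * (ln y - ln (y - 1)) \<le> 1"
proof -
  have "ln y - ln (y - 1) = ln (1 + 1 / (y - 1))"
    using ln_div[of y "y - 1"] assms by (simp add: field_simps)
  also have "\<dots> \<le> 1 / (y - 1)"
    using assms by (intro ln_add_one_self_le_self) simp
  finally show ?thesis
    using assms by (simp add: field_simps)
qed

text \<open>An integral comparison in discrete form: s ln s - s is an antiderivative of ln, and
  \<open>ln_step_bound\<close> says exactly that its increment from s - 1 to s is at most ln
  s.\<close>

lemma sum_ln_lower:
  fixes f :: real and n :: nat
  assumes "f > 0"
  shows "((f + n) * ln (f + n) - (f + n)) - (f * ln f - f) \<le> (\<Sum>i=1..n. ln (f + i))"
proof (induction n)
  case (Suc n)
  show ?case
    using Suc ln_step_bound[of "f + Suc n"] assms by (simp add: algebra_simps)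
qed simp

lemma sum_ln_floor_approx:
  fixes y :: real
  assumes y: "y > 1" "y \<notin> \<rat>"
  shows "\<bar>(\<Sum>i=1..<nat \<lfloor>y\<rfloor>. ln (y - i)) - y * ln y\<bar> \<le> 2 * y"
proof -
  \<comment> \<open>\<open>a\<close> is the number of summands and \<open>f\<close> is the
    fractional part of y. Read backwards, the arguments of ln are f + 1, ..., f + a = y - 1.\<close>
  define a where "a = nat \<lfloor>y\<rfloor> - 1"
  define f where "f = y - 1 - a"
  have f: "0 < f" "f < 1" and na: "nat \<lfloor>y\<rfloor> = Suc a"
    unfolding a_def f_def using y(1) frac_pos_irrational[OF y(2)] unfolding frac_def by linarith+
  have y_eq: "y = f + 1 + a"
    by (simp add: f_def)
  let ?S = "\<Sum>i=1..<nat \<lfloor>y\<rfloor>. ln (y - i)"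
  have S_eq: "?S = (\<Sum>i=1..a. ln (f + i))"
    unfolding na atLeastLessThanSuc_atLeastAtMost
    by (rule sum.reindex_bij_witness[where i = "\<lambda>i. Suc a - i" and j = "\<lambda>i. Suc a - i"])
       (auto simp: y_eq of_nat_diff algebra_simps)
  have "?S \<le> (\<Sum>i=1..a. ln y)"
    unfolding S_eq using f y by (intro sum_mono) (auto simp: y_eq)
  also have "\<dots> = a * ln y"
    by simp
  also have "\<dots> \<le> y * ln y"
    using y f by (intro mult_right_mono) (auto simp: y_eq)
  finally have upper: "?S \<le> y * ln y" .
  have "f * ln f - f \<le> 0"
    using f by (smt (verit) ln_le_zero_iff mult_nonneg_nonpos)
  moreover have y1: "y - 1 = f + a"
    by (simp add: y_eq)
  ultimately have "(y - 1) * ln (y - 1) - (y - 1) \<le> ?S"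
    using sum_ln_lower[OF f(1), of a] unfolding S_eq y1 by linarith
  \<comment> \<open>The left side is ln y + (y - 1) (ln y - ln (y - 1)), at most (y - 1) + 1. With
    the loss y - 1 of the previous bound, the total stays below 2y.\<close>
  moreover have "y * ln y - (y - 1) * ln (y - 1) \<le> y"
    using ln_step_bound[OF y(1)] ln_le_minus_one[of y] y by (simp add: algebra_simps)
  ultimately show ?thesis
    using upper y by linarith
qed

text \<open>The even terms force a limit \<ge> 0 and the odd terms a limit \<le> 0, so the limit is
  0 and absolute values may be taken.\<close>

lemma convergent_alternating_iff:
  fixes t :: "nat \<Rightarrow> real"
  assumes "\<And>n. t n \<ge> 0"
  shows "convergent (\<lambda>n. (- 1) ^ n * t n) \<longleftrightarrow> t \<longlonglongrightarrow> 0"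
proof
  assume "convergent (\<lambda>n. (- 1) ^ n * t n)"
  then obtain l where l: "(\<lambda>n. (- 1) ^ n * t n) \<longlonglongrightarrow> l"
    by (auto simp: convergent_def)
  have "(\<lambda>n. (- 1) ^ (2 * n) * t (2 * n)) \<longlonglongrightarrow> l"
    using LIMSEQ_subseq_LIMSEQ[OF l, of "\<lambda>n. 2 * n"] by (simp add: o_def strict_mono_def)
  then have "l \<ge> 0"
    by (rule LIMSEQ_le_const) (simp add: assms)
  have "(\<lambda>n. (- 1) ^ (Suc (2 * n)) * t (Suc (2 * n))) \<longlonglongrightarrow> l"
    using LIMSEQ_subseq_LIMSEQ[OF l, of "\<lambda>n. Suc (2 * n)"] by (simp add: o_def strict_mono_def)
  then have "l \<le> 0"
    by (rule LIMSEQ_le_const2) (simp add: assms)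
  with \<open>l \<ge> 0\<close> l have "(\<lambda>n. \<bar>(- 1) ^ n * t n\<bar>) \<longlonglongrightarrow> 0"
    using tendsto_rabs_zero by fastforce
  then show "t \<longlonglongrightarrow> 0"
    using assms by (simp add: abs_mult power_abs)
next
  assume "t \<longlonglongrightarrow> 0"
  then have "(\<lambda>n. \<bar>(- 1) ^ n * t n\<bar>) \<longlonglongrightarrow> 0"
    using assms by (simp add: abs_mult power_abs)
  then show "convergent (\<lambda>n. (- 1) ^ n * t n)"
    using tendsto_rabs_zero_iff convergentI by blast
qed

section \<open>The backward orbit\<close>

context
  fixes p :: rpoint and k :: real
  assumes k_orbit_0_eq: "k_orbit p 0 = k" and k_gt_1: "k > 1" and irrational_k: "k \<notin> \<rat>"
begin

abbreviation (input) "K \<equiv> cf_complete_quotient k"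
abbreviation (input) "P \<equiv> cf_quotient_prod k"

lemma K_gt_1: "K m > 1"
  using k_gt_1 cf_complete_quotient_gt_1[OF irrational_k] by (cases m) auto

lemma floor_K_bounds: "1 \<le> nat \<lfloor>K m\<rfloor>" "real (nat \<lfloor>K m\<rfloor>) < K m" "K m < real (nat \<lfloor>K m\<rfloor>) + 1"
proof -
  have "0 < frac (K m)"
    using frac_pos_irrational cf_complete_quotient_irrational irrational_k by blast
  then show "1 \<le> nat \<lfloor>K m\<rfloor>" "real (nat \<lfloor>K m\<rfloor>) < K m" "K m < real (nat \<lfloor>K m\<rfloor>) + 1"
    using K_gt_1[of m] unfolding frac_def by linarith+
qed

text \<open>As long as the orbit stays above 2, each backward step is \<open>S\<close> inverse and
  subtracts 1; the bound on \<open>i\<close> keeps every point from which a step is taken above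
  2.\<close>

lemma k_orbit_block:
  assumes "n \<le> 0" "k_orbit p n = K m" "i < nat \<lfloor>K m\<rfloor>"
  shows "k_orbit p (n - int i) = K m - i"
  using assms(3)
proof (induction i)
  case 0
  then show ?case using assms by simp
next
  case (Suc i)
  then have "k_orbit p (n - int i) = K m - i" by simp
  moreover have "K m - i > 2"
    using Suc.prems floor_K_bounds[of m] by linarith
  ultimately show ?case
    using k_orbit_backward_step[of "n - int i" p] assms(1) by (simp add: algebra_simps)
qed

text \<open>One block is one step of the continued fraction algorithm: subtractions bring
  \<open>K m\<close> down to 1 + \<open>frac (K m)\<close>, the first value below 2, and then
  \<open>D\<close> inverse yields 1 / \<open>frac (K m)\<close>, the next complete quotient.\<close>

lemma D_index_aux_step:
  assumes n: "D_index_aux p m \<le> 0" "k_orbit p (D_index_aux p m) = K m"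
  shows "D_index_aux p (Suc m) = D_index_aux p m - nat \<lfloor>K m\<rfloor>"
    and "k_orbit p (D_index_aux p (Suc m)) = K (Suc m)"
proof -
  let ?n = "D_index_aux p m" and ?a = "nat \<lfloor>K m\<rfloor>"
  note a = floor_K_bounds[of m]
  \<comment> \<open>The index condition tests the orbit at i + 1, so the point below 2 sits at
    \<open>?n - ?a + 1\<close> while the new index is \<open>?n - ?a\<close>.\<close>
  have last: "k_orbit p (?n - ?a + 1) = 1 + frac (K m)"
    using k_orbit_block[OF n, of "?a - 1"] a by (simp add: of_nat_diff frac_def algebra_simps)
  show eq: "D_index_aux p (Suc m) = ?n - ?a"
    unfolding D_index_aux.simps
  proof (rule Greatest_equality)
    show "?n - ?a < ?n \<and> k_orbit p (?n - ?a + 1) < 2"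
      using a last frac_lt_1[of "K m"] by simp
  next
    fix i
    assume i: "i < ?n \<and> k_orbit p (i + 1) < 2"
    show "i \<le> ?n - ?a"
    proof (rule ccontr)
      assume "\<not> i \<le> ?n - ?a"
      \<comment> \<open>A larger i would test a point \<open>K m - j\<close> with j + 2 \<le>
        \<open>?a\<close>, which is still above 2.\<close>
      then obtain j where j: "Suc j < ?a" "i + 1 = ?n - int j"
        using i a that[of "nat (?n - i - 1)"] by linarith
      then have "k_orbit p (i + 1) = K m - j"
        using k_orbit_block[OF n, of j] by (simp only: Suc_lessD)
      then show False
        using i j a by linarith
    qed
  qed
  have "k_orbit p (?n - ?a + 1 - 1) = 1 / frac (K m)"
    using k_orbit_backward_step[of "?n - ?a + 1" p] n(1) a last frac_lt_1[of "K m"]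
    by (simp add: cf_complete_quotient_Suc)
  then show "k_orbit p (D_index_aux p (Suc m)) = K (Suc m)"
    unfolding eq by (simp add: cf_complete_quotient_Suc)
qed

lemma D_index_aux_orbit: "D_index_aux p m \<le> 0 \<and> k_orbit p (D_index_aux p m) = K m"
proof (induction m)
  case 0
  show ?case using k_orbit_0_eq by simp
next
  case (Suc m)
  then show ?case
    using D_index_aux_step[of m] by (metis diff_le_0_iff_le of_nat_0_le_iff order_trans)
qed

lemma k_orbit_D_index: "k_orbit p (D_index p (- int m)) = K m"
  by (simp add: D_index_def D_index_aux_orbit)

text \<open>The half-open range omits the upper end, where the orbit equals \<open>K m\<close>, and
  contains the lower end, where it equals \<open>K (Suc m)\<close>. The latter is split off because
  it belongs to the next complete quotient.\<close>

lemma sum_u_block: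
  "(\<Sum>v\<in>{D_index p (- int m - 1)..<D_index p (- int m)}. u (k_orbit p v)) =
     u (K (Suc m)) + (\<Sum>i=1..<nat \<lfloor>K m\<rfloor>. u (K m - i))"
proof -
  let ?n = "D_index_aux p m" and ?a = "nat \<lfloor>K m\<rfloor>"
  have n: "?n \<le> 0" "k_orbit p ?n = K m"
    using D_index_aux_orbit by blast+
  note step = D_index_aux_step[OF n]
  have "nat (1 + int m) = Suc m"
    by simp
  then have D: "D_index p (- int m - 1) = ?n - ?a" "D_index p (- int m) = ?n"
    using step(1) by (simp_all add: D_index_def)
  have "(\<Sum>v\<in>{?n - int b..<?n}. u (k_orbit p v)) = (\<Sum>i\<in>{1..b}. u (k_orbit p (?n - int i)))"
    for b :: nat
    by (rule sum.reindex_bij_witness[where i = "\<lambda>i. ?n - int i" and j = "\<lambda>v. nat (?n - v)"]) auto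
  then have "(\<Sum>v\<in>{?n - ?a..<?n}. u (k_orbit p v)) = (\<Sum>i\<in>{1..?a}. u (k_orbit p (?n - int i)))" .
  also have "{1..?a} = insert ?a {1..<?a}"
    using floor_K_bounds[of m] by auto
  also have "(\<Sum>i\<in>insert ?a {1..<?a}. u (k_orbit p (?n - int i))) =
      u (k_orbit p (?n - ?a)) + (\<Sum>i=1..<?a. u (k_orbit p (?n - int i)))"
    by simp
  also have "k_orbit p (?n - ?a) = K (Suc m)"
    using step by (simp only:)
  also have "(\<Sum>i=1..<?a. u (k_orbit p (?n - int i))) = (\<Sum>i=1..<?a. u (K m - i))"
    using k_orbit_block[OF n] by (intro sum.cong) auto
  finally show ?thesis
    unfolding D .
qed

section \<open>Asymptotics of the summands and telescoping\<close>

lemma unstable_summand_eq: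
  "unstable_summand p (- int m) =
     (- 1) ^ m * inverse (P m) * (u (K (Suc m)) + (\<Sum>i=1..<nat \<lfloor>K m\<rfloor>. u (K m - i)))"
proof -
  have "(\<Prod>j\<in>{- int m..-1}. - inverse (k_orbit p (D_index p j))) = (\<Prod>j=1..m. - inverse (K j))"
    by (rule prod.reindex_bij_witness[where i = "\<lambda>i. - int i" and j = "\<lambda>v. nat (- v)"])
       (auto simp: D_index_def D_index_aux_orbit)
  also have "\<dots> = (- 1) ^ m * inverse (P m)"
    by (induction m) (simp_all add: cf_quotient_prod_Suc ac_simps)
  finally show ?thesis
    unfolding unstable_summand_def by (simp add: sum_u_block)
qed

lemma sum_unstable_summand:
  "(\<Sum>J\<in>{- int N..0}. unstable_summand p J) = (\<Sum>m\<le>N. unstable_summand p (- int m))"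
  by (rule sum.reindex_bij_witness[where i = "\<lambda>m. - int m" and j = "\<lambda>J. nat (- J)"]) auto

definition main_term :: "nat \<Rightarrow> real" where
  "main_term m = 3 * ln (K (Suc m)) / P m"

text \<open>With y = \<open>K (Suc m)\<close>, the lower end of the block gives
  \<open>main_term (Suc m)\<close>, and the remaining sum is about 3 y ln y. Division by
  \<open>P (Suc m)\<close> = y \<open>P m\<close> turns this into \<open>main_term m\<close>, and an
  error of order y into one of order 1 / \<open>P m\<close>.\<close>

lemma unstable_summand_Suc_approx:
  "\<exists>C. \<forall>m. \<bar>unstable_summand p (- int (Suc m)) - (- 1) ^ Suc m * (main_term (Suc m) + main_term m)\<bar>
     \<le> C * inverse (P m)"
proof -
  obtain R where R: "R \<ge> 0" "\<And>y. y > 1 \<Longrightarrow> \<bar>u y - 3 * ln y\<bar> \<le> R"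
    using u_approx by blast
  have "\<bar>unstable_summand p (- int (Suc m)) - (- 1) ^ Suc m * (main_term (Suc m) + main_term m)\<bar>
     \<le> (R + 6) * inverse (P m)" for m
  proof -
    let ?y = "K (Suc m)" and ?z = "K (Suc (Suc m))"
    let ?a = "nat \<lfloor>?y\<rfloor>"
    note a = floor_K_bounds[of "Suc m"]
    have y: "?y > 1" and z: "?z > 1"
      using K_gt_1 by blast+
    have P: "P m \<ge> 1"
      using cf_quotient_prod_ge_1[OF irrational_k] .
    define S where "S = u ?z + (\<Sum>i=1..<?a. u (?y - i))"
    have "\<bar>(\<Sum>i=1..<?a. u (?y - i)) - 3 * (\<Sum>i=1..<?a. ln (?y - i))\<bar> =
        \<bar>\<Sum>i=1..<?a. (u (?y - i) - 3 * ln (?y - i))\<bar>"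
      by (simp add: sum_subtractf sum_distrib_left)
    also have "\<dots> \<le> (\<Sum>i=1..<?a. R)"
    proof (intro order.trans[OF sum_abs] sum_mono R(2))
      fix i
      assume "i \<in> {1..<?a}"
      then show "1 < ?y - real i"
        using a by auto
    qed
    also have "\<dots> = (real ?a - 1) * R"
      using a by (simp add: of_nat_diff)
    also have "\<dots> \<le> (?y - 1) * R"
      using a R(1) by (intro mult_right_mono) linarith+
    finally have 1: "\<bar>(\<Sum>i=1..<?a. u (?y - i)) - 3 * (\<Sum>i=1..<?a. ln (?y - i))\<bar> \<le> (?y - 1) * R" .
    \<comment> \<open>The three errors come from u at z, from u at the \<open>?a - 1\<close> inner
      points, and from three times the Stirling error 2y.\<close>
    have "\<bar>S - (3 * ln ?z + 3 * (?y * ln ?y))\<bar> \<le> R + (?y - 1) * R + 6 * ?y"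
      using 1 R(2)[OF z] sum_ln_floor_approx[OF y cf_complete_quotient_irrational[OF irrational_k]]
      unfolding S_def by linarith
    also have "\<dots> = (R + 6) * ?y"
      by (simp add: algebra_simps)
    finally have 2: "\<bar>S - (3 * ln ?z + 3 * (?y * ln ?y))\<bar> \<le> (R + 6) * ?y" .
    have P': "P (Suc m) > 0"
      using cf_quotient_prod_ge_1[OF irrational_k, of "Suc m"] by linarith
    have mt: "main_term (Suc m) + main_term m = inverse (P (Suc m)) * (3 * ln ?z + 3 * (?y * ln ?y))"
      using P y by (simp add: main_term_def cf_quotient_prod_Suc field_simps)
    have "unstable_summand p (- int (Suc m)) - (- 1) ^ Suc m * (main_term (Suc m) + main_term m) =
        (- 1) ^ Suc m * (inverse (P (Suc m)) * (S - (3 * ln ?z + 3 * (?y * ln ?y))))"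
      unfolding mt unstable_summand_eq S_def[symmetric]
      by (simp add: algebra_simps)
    then have "\<bar>unstable_summand p (- int (Suc m)) - (- 1) ^ Suc m * (main_term (Suc m) + main_term m)\<bar>
        = inverse (P (Suc m)) * \<bar>S - (3 * ln ?z + 3 * (?y * ln ?y))\<bar>"
      using P' by (simp only: abs_mult power_abs) simp
    also have "\<dots> \<le> inverse (P (Suc m)) * ((R + 6) * ?y)"
      using 2 P' by (intro mult_left_mono) auto
    also have "\<dots> = (R + 6) * inverse (P m)"
      using y P by (simp add: cf_quotient_prod_Suc field_simps)
    finally show ?thesis .
  qed
  then show ?thesis by blast
qed

lemma sum_main_terms:
  "(\<Sum>m<N. (- 1) ^ Suc m * (main_term (Suc m) + main_term m)) = (- 1) ^ N * main_term N - main_term 0"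
  by (induction N) (simp_all add: algebra_simps)

lemma convergent_unstable_series_iff:
  "convergent (\<lambda>N::nat. \<Sum>J\<in>{- int N..0}. unstable_summand p J) \<longleftrightarrow>
   (\<lambda>j. ln (K (Suc j)) / P j) \<longlonglongrightarrow> 0"
proof -
  let ?s = "\<lambda>m. unstable_summand p (- int m)"
  let ?g = "\<lambda>m. (- 1) ^ Suc m * (main_term (Suc m) + main_term m)"
  obtain C where C: "\<And>m. \<bar>?s (Suc m) - ?g m\<bar> \<le> C * inverse (P m)"
    using unstable_summand_Suc_approx by blast
  have err: "summable (\<lambda>m. ?s (Suc m) - ?g m)"
    by (rule summable_comparison_test'[OF summable_mult[OF summable_inverse_cf_quotient_prod[OF irrational_k]]])
       (use C in simp)
  have nonneg: "main_term m \<ge> 0" for m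
    using cf_quotient_prod_ge_1[OF irrational_k, of m] K_gt_1[of "Suc m"]
    by (simp add: main_term_def)
  have "convergent (\<lambda>N::nat. \<Sum>J\<in>{- int N..0}. unstable_summand p J) \<longleftrightarrow> summable ?s"
    by (simp add: sum_unstable_summand summable_iff_convergent')
  \<comment> \<open>The summand with J = 0 is dropped, since the approximation pairs
    \<open>main_term (Suc m)\<close> with \<open>main_term m\<close> and so starts at J =
    -1.\<close>
  also have "\<dots> \<longleftrightarrow> summable (\<lambda>m. ?s (Suc m))"
    by (rule summable_Suc_iff[symmetric])
  also have "\<dots> \<longleftrightarrow> summable ?g"
    using summable_diff[OF _ err] summable_add[OF _ err] by fastforce
  also have "\<dots> \<longleftrightarrow> convergent (\<lambda>N. (- 1) ^ N * main_term N - main_term 0)"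
    by (simp only: summable_iff_convergent sum_main_terms)
  also have "\<dots> \<longleftrightarrow> convergent (\<lambda>N. (- 1) ^ N * main_term N)"
    by (simp add: convergent_diff_const_right_iff)
  also have "\<dots> \<longleftrightarrow> main_term \<longlonglongrightarrow> 0"
    using nonneg by (rule convergent_alternating_iff)
  also have "\<dots> \<longleftrightarrow> (\<lambda>j. 3 * (ln (K (Suc j)) / P j)) \<longlonglongrightarrow> 0"
    by (simp add: main_term_def[abs_def])
  also have "\<dots> \<longleftrightarrow> (\<lambda>j. ln (K (Suc j)) / P j) \<longlonglongrightarrow> 0"
    using tendsto_mult_left_iff[of "3::real" "\<lambda>j. ln (K (Suc j)) / P j" 0] by simp
  finally show ?thesis .
qed

end

theorem proposition1p1:
  fixes \<omega> k a A :: real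
  assumes "\<omega> > 0" and "k > 1" and "k \<notin> \<rat>"
  defines "p \<equiv> (\<omega>, k, a, A)"
  defines "x \<equiv> inverse (k_orbit p (D_index p (-1)))"
  shows "convergent (\<lambda>N::nat. \<Sum>J\<in>{- int N..0}. unstable_summand p J) \<longleftrightarrow>
    (\<lambda>j. ln (real_of_int (cf_denom x (Suc j))) / real_of_int (cf_denom x j)) \<longlonglongrightarrow> 0"
proof -
  have p0: "k_orbit p 0 = k"
    by (simp add: p_def k_orbit_0)
  \<comment> \<open>The orbit at index n with subscript -1 is \<open>K 1\<close> = 1 /
    \<open>frac k\<close>.\<close>
  have x: "x = frac k"
    using k_orbit_D_index[OF p0 assms(2,3), of 1] by (simp add: x_def cf_complete_quotient_Suc)
  have "frac k \<notin> \<rat>"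
  proof
    assume "frac k \<in> \<rat>"
    then have "frac k + of_int \<lfloor>k\<rfloor> \<in> \<rat>"
      by (intro Rats_add) auto
    then show False
      using assms(3) by (simp add: frac_def)
  qed
  from ln_cf_denom_tendsto_iff[OF this] show ?thesis
    unfolding x convergent_unstable_series_iff[OF p0 assms(2,3)]
    by (simp only: cf_complete_quotient_frac cf_quotient_prod_frac)
qed

end
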